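(* Let $n\ge 1$ and $r\ge 0$ be integers. There exist injective maps $\varphi:\mathcal{B}\to [n]^r\times[n]^r$ and $\psi:\mathcal{C}\to[n]^r\times[n]^r$ such that: (i) for every $\sigma\in\mathcal{B}$, if $\varphi(\sigma)=(\underline{i},\underline{j})$ then $\sigma$ is the unique element of minimal Coxeter length in the set $\{\sigma'\in\mathcal{B}\mid \underline{i}\,\sigma'=\underline{j}\}$; (ii) for every $w\in\mathcal{C}$, if $\psi(w)=(\underline{i},\underline{j})$ then $w$ is the unique element of minimal Coxeter length in the set $\{w'\in\mathcal{C}\mid w'\underline{j}=\underline{i}\}$.
   Context: $[n]=\{1,\dots,n\}$. $\mathfrak{S}_r$ is the symmetric group on $[r]$ and $W_n$ is the symmetric group on $[n]$. For a permutation $\sigma$, written in one-line notation as $(\sigma(1),\sigma(2),\dots)$, $\operatorname{LLIS}(\sigma)$ (resp. $\operatorname{LLDS}(\sigma)$) is the length of a longest increasing (resp. decreasing) subsequence of this sequence. Set $\mathcal{B}=\{\sigma\in\mathfrak{S}_r\mid \operatorname{LLDS}(\sigma)\le n\}$ and $\mathcal{C}=\{w\in W_n\mid \operatorname{LLIS}(w)\ge n-r\}$. For $\underline{j}=(j_1,\dots,j_r)\in[n]^r$, $\sigma\in\mathfrak{S}_r$, $w\in W_n$, define $\underline{j}\,\sigma=(j_{\sigma(1)},\dots,j_{\sigma(r)})$ and $w\underline{j}=(w(j_1),\dots,w(j_r))$. The Coxeter length of a permutation is its number of inversions (pairs $a<b$ whose values satisfy $\sigma(a)>\sigma(b)$).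 *)

theory Defs
  imports "HOL-Library.FuncSet" "HOL-Combinatorics.Permutations"
begin

text \<open>
  A permutation of \<open>[m]\<close> is a function \<open>\<sigma> :: nat \<Rightarrow> nat\<close> with \<open>\<sigma> permutes {1..m}\<close>; in particular
  it is the identity outside \<open>{1..m}\<close>, so that equality of such functions is equality of
  permutations.
\<close>

definition sym_group :: "nat \<Rightarrow> (nat \<Rightarrow> nat) set" where
  "sym_group m = {\<sigma>. \<sigma> permutes {1..m}}"

text \<open>
  A subsequence of \<open>(\<sigma>(1), \<dots>, \<sigma>(m))\<close> is given by its set \<open>A\<close> of positions, and its length
  is \<open>card A\<close>. The set of candidates is finite and contains the empty set, so \<open>Max\<close> is proper
  for all \<open>m\<close>, including \<open>m = 0\<close>.
\<close>

definition LLIS :: "nat \<Rightarrow> (nat \<Rightarrow> nat) \<Rightarrow> nat" where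
  "LLIS m \<sigma> = Max (card ` {A. A \<subseteq> {1..m} \<and> strict_mono_on A \<sigma>})"

definition LLDS :: "nat \<Rightarrow> (nat \<Rightarrow> nat) \<Rightarrow> nat" where
  "LLDS m \<sigma> = Max (card ` {A. A \<subseteq> {1..m} \<and> monotone_on A (<) (>) \<sigma>})"

definition coxeter_length :: "nat \<Rightarrow> (nat \<Rightarrow> nat) \<Rightarrow> nat" where
  "coxeter_length m \<sigma> = card {(a, b). a \<in> {1..m} \<and> b \<in> {1..m} \<and> a < b \<and> \<sigma> a > \<sigma> b}"

definition perms_B :: "nat \<Rightarrow> nat \<Rightarrow> (nat \<Rightarrow> nat) set" where
  "perms_B n r = {\<sigma> \<in> sym_group r. LLDS r \<sigma> \<le> n}"

text \<open>The bound is an integer inequality: \<open>n - r\<close> may be negative.\<close>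

definition perms_C :: "nat \<Rightarrow> nat \<Rightarrow> (nat \<Rightarrow> nat) set" where
  "perms_C n r = {w \<in> sym_group n. int (LLIS n w) \<ge> int n - int r}"

definition tuples :: "nat \<Rightarrow> nat \<Rightarrow> (nat \<Rightarrow> nat) set" where
  "tuples n r = {1..r} \<rightarrow>\<^sub>E {1..n}"

definition place_act :: "nat \<Rightarrow> (nat \<Rightarrow> nat) \<Rightarrow> (nat \<Rightarrow> nat) \<Rightarrow> (nat \<Rightarrow> nat)" where
  "place_act r j \<sigma> = (\<lambda>k\<in>{1..r}. j (\<sigma> k))"

definition value_act :: "nat \<Rightarrow> (nat \<Rightarrow> nat) \<Rightarrow> (nat \<Rightarrow> nat) \<Rightarrow> (nat \<Rightarrow> nat)" where
  "value_act r w j = (\<lambda>k\<in>{1..r}. w (j k))"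

definition unique_min_length :: "nat \<Rightarrow> (nat \<Rightarrow> nat) set \<Rightarrow> (nat \<Rightarrow> nat) \<Rightarrow> bool" where
  "unique_min_length m S \<sigma> \<longleftrightarrow> {\<tau>. is_arg_min (coxeter_length m) (\<lambda>\<rho>. \<rho> \<in> S) \<tau>} = {\<sigma>}"

end

theory Submission
  imports Defs
begin

text \<open>
  Injectivity is automatic: if \<open>\<sigma>\<close> is the unique shortest element of a set that depends only on
  \<open>\<phi> \<sigma>\<close>, then \<open>\<phi> \<sigma>\<close> determines \<open>\<sigma>\<close>, and likewise for \<open>\<psi>\<close>. So it suffices to find, separately
  for each permutation, a pair of tuples that singles it out.

  Both parts come from one principle. Colour the positions \<open>1, \<dots>, m\<close>, let \<open>\<sigma>\<close> be increasing on each
  colour class, and compare it with all \<open>\<tau>\<close> that send every colour class to the same set of values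
  as \<open>\<sigma>\<close> does. If such a \<open>\<tau>\<close> is not increasing on some class, exchanging two of its values there
  makes it strictly shorter and keeps the value sets; if it is increasing on all classes, it
  equals \<open>\<sigma>\<close>. So \<open>\<sigma>\<close> is strictly shorter than every competitor
  (\<open>coxeter_length_less_if_increasing_on_colours\<close>). As \<open>\<sigma>\<close> is shortest among all permutations
  with these value sets, it remains so among those in \<open>\<B>\<close> or \<open>\<C>\<close>.

  For \<open>\<B>\<close>, a permutation without decreasing subsequences of length greater than \<open>n\<close> is a union of \<open>n\<close>
  increasing ones: colour a position by the length of a longest decreasing subsequence that ends
  there. The tuple \<open>j\<close> records the colours of the positions and \<open>i\<close> those of the values, and
  \<open>i \<tau> = j\<close> says exactly that \<open>\<tau>\<close> has the value sets of \<open>\<sigma>\<close>.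
  For \<open>\<C>\<close>, the entries of \<open>j\<close> enumerate the at most \<open>r\<close> positions outside a longest increasing
  subsequence of \<open>w\<close>, and \<open>i = w j\<close>. Then \<open>w' j = i\<close> says that \<open>w'\<close> agrees with \<open>w\<close> at these positions;
  give each of them a colour of its own and all remaining positions one common colour.
\<close>

section \<open>Shortest permutations with prescribed values on colour classes\<close>

text \<open>
  An inversion of the new permutation is moved along the transposition whenever that
  preserves the order of the two positions, and is left in place otherwise. The result is always
  an inversion of the old permutation, and the exchanged pair itself is never reached.
\<close>
lemma coxeter_length_transpose_less:
  assumes "a \<in> {1..m}" "b \<in> {1..m}" "a < b" "\<sigma> b < \<sigma> a"
  shows "coxeter_length m (\<sigma> \<circ> transpose a b) < coxeter_length m \<sigma>"
proof -
  define Inv where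
    "Inv \<rho> = {(x, y). x \<in> {1..m} \<and> y \<in> {1..m} \<and> x < y \<and> \<rho> x > \<rho> y}" for \<rho> :: "nat \<Rightarrow> nat"
  let ?t = "transpose a b"
  define g where "g = (\<lambda>(x, y). if ?t x < ?t y then (?t x, ?t y) else (x, y))"
  have fin: "finite (Inv \<sigma>)"
    by (rule finite_subset[of _ "{1..m} \<times> {1..m}"]) (auto simp: Inv_def)
  have inj: "inj_on g (Inv (\<sigma> \<circ> ?t))"
  proof (rule inj_onI)
    fix p q assume pq: "p \<in> Inv (\<sigma> \<circ> ?t)" "q \<in> Inv (\<sigma> \<circ> ?t)" "g p = g q"
    obtain x y x' y' where eq: "p = (x, y)" "q = (x', y')" by (cases p, cases q)
    with pq have "x < y" "x' < y'" by (auto simp: Inv_def)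
    with pq(3) show "p = q"
      by (auto simp: eq g_def inj_eq[OF inj_transpose] split: if_splits)
  qed
  have "g ` Inv (\<sigma> \<circ> ?t) \<subseteq> Inv \<sigma> - {(a, b)}"
  proof (rule image_subsetI)
    fix p assume "p \<in> Inv (\<sigma> \<circ> ?t)"
    then obtain x y where p: "p = (x, y)"
      and xy: "x \<in> {1..m}" "y \<in> {1..m}" "x < y" "\<sigma> (?t x) > \<sigma> (?t y)"
      by (auto simp: Inv_def)
    show "g p \<in> Inv \<sigma> - {(a, b)}"
    proof (cases "?t x < ?t y")
      case True
      have mem: "?t z \<in> {1..m}" if "z \<in> {1..m}" for z
        using that assms(1,2) by (simp add: transpose_def)
      have "?t x \<noteq> a \<or> ?t y \<noteq> b"
        using xy(3) assms(3)
        by (metis less_asym transpose_apply_first transpose_apply_second transpose_involutory)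
      with True xy mem show ?thesis by (simp add: p g_def Inv_def)
    next
      case False
      \<comment> \<open>The reversed pairs are \<open>(a, b)\<close>, which is no longer an inversion, and \<open>(a, z)\<close> and \<open>(z, b)\<close>
        with \<open>z\<close> strictly between \<open>a\<close> and \<open>b\<close>.\<close>
      have "x = a \<and> y \<noteq> a \<and> y \<noteq> b \<or> y = b \<and> x \<noteq> a \<and> x \<noteq> b"
        using False xy(3,4) assms(3,4) unfolding transpose_def
        by (smt (verit) less_trans less_asym nat_neq_iff)
      with xy assms(4) have "\<sigma> y < \<sigma> x" "p \<noteq> (a, b)" by (auto simp: p)
      with False xy show ?thesis by (simp add: p g_def Inv_def)
    qed
  qed
  then have "card (Inv (\<sigma> \<circ> ?t)) \<le> card (Inv \<sigma> - {(a, b)})"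
    by (rule card_inj_on_le[OF inj]) (use fin in simp)
  also have "\<dots> < card (Inv \<sigma>)"
    using fin assms by (intro card_Diff1_less) (auto simp: Inv_def)
  finally show ?thesis by (simp add: coxeter_length_def Inv_def)
qed

text \<open>
  The smallest point moved by a permutation is the image of a larger one, and itself goes to a
  larger one; so a colour-preserving permutation that moves a point has a descent inside a colour class.
\<close>
lemma colour_preserving_increasing_eq_id:
  fixes f :: "nat \<Rightarrow> 'c"
  assumes perm: "\<tau> permutes {1..m}"
    and colour: "\<And>k. k \<in> {1..m} \<Longrightarrow> f (\<tau> k) = f k"
    and incr: "\<And>a b. a \<in> {1..m} \<Longrightarrow> b \<in> {1..m} \<Longrightarrow> a < b \<Longrightarrow> f a = f b \<Longrightarrow> \<tau> a < \<tau> b"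
  shows "\<tau> = id"
proof (rule ccontr)
  assume "\<tau> \<noteq> id"
  then have ex: "\<exists>k. \<tau> k \<noteq> k" by (auto simp: fun_eq_iff)
  define k where "k = (LEAST k. \<tau> k \<noteq> k)"
  have k: "\<tau> k \<noteq> k" unfolding k_def by (rule LeastI_ex[OF ex])
  have below: "\<tau> l = l" if "l < k" for l
    using not_less_Least[of l "\<lambda>k. \<tau> k \<noteq> k"] that by (auto simp: k_def)
  have inj: "\<tau> x = \<tau> y \<longleftrightarrow> x = y" for x y
    using permutes_inj[OF perm] by (auto dest: injD)
  have km: "k \<in> {1..m}" using k permutes_not_in[OF perm] by blast
  obtain l where l: "\<tau> l = k" using permutes_surj[OF perm] by (metis surjD)
  have lm: "l \<in> {1..m}" using l km permutes_in_image[OF perm] by blast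
  have "l > k" using below[of l] l k by (cases l k rule: linorder_cases) auto
  moreover have "f k = f l" using colour[OF lm] l by simp
  ultimately have "\<tau> k < k" using incr[OF km lm] l by simp
  then show False using below[of "\<tau> k"] inj k by blast
qed

text \<open>
  The condition on \<open>\<tau>\<close> says that \<open>\<sigma>\<close> and \<open>\<tau>\<close> send each colour class to the same set of values.
\<close>
lemma coxeter_length_less_if_increasing_on_colours:
  fixes f :: "nat \<Rightarrow> 'c"
  assumes \<sigma>: "\<sigma> permutes {1..m}"
    and incr: "\<And>a b. a \<in> {1..m} \<Longrightarrow> b \<in> {1..m} \<Longrightarrow> a < b \<Longrightarrow> f a = f b \<Longrightarrow> \<sigma> a < \<sigma> b"
    and "\<tau> permutes {1..m}"
    and "\<And>k. k \<in> {1..m} \<Longrightarrow> f (inv \<sigma> (\<tau> k)) = f k"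
    and "\<tau> \<noteq> \<sigma>"
  shows "coxeter_length m \<sigma> < coxeter_length m \<tau>"
  using assms(3-5)
proof (induction "coxeter_length m \<tau>" arbitrary: \<tau> rule: less_induct)
  case less
  note \<tau> = less.prems(1) and colour = less.prems(2)
  have "\<exists>a\<in>{1..m}. \<exists>b\<in>{1..m}. a < b \<and> f a = f b \<and> \<tau> b < \<tau> a"
  proof (rule ccontr)
    assume no_descent: "\<not> ?thesis"
    have perm: "inv \<sigma> \<circ> \<tau> permutes {1..m}"
      by (rule permutes_compose[OF \<tau> permutes_inv[OF \<sigma>]])
    have "inv \<sigma> \<circ> \<tau> = id"
    proof (rule colour_preserving_increasing_eq_id[OF perm])
      show "f ((inv \<sigma> \<circ> \<tau>) k) = f k" if "k \<in> {1..m}" for k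
        using colour[OF that] by simp
      fix a b assume ab: "a \<in> {1..m}" "b \<in> {1..m}" "a < b" "f a = f b"
      let ?x = "inv \<sigma> (\<tau> a)" and ?y = "inv \<sigma> (\<tau> b)"
      have mem: "?x \<in> {1..m}" "?y \<in> {1..m}"
        using ab permutes_in_image[OF perm] by auto
      have col: "f ?x = f ?y" using ab colour by simp
      have "\<tau> a \<noteq> \<tau> b" using ab permutes_inj[OF \<tau>] by (auto dest: injD)
      then have lt: "\<sigma> ?x < \<sigma> ?y"
        using ab no_descent by (force simp: permutes_inverses(1)[OF \<sigma>])
      then have "\<not> ?y < ?x" "?x \<noteq> ?y" using incr[OF mem(2,1)] col by auto
      then show "(inv \<sigma> \<circ> \<tau>) a < (inv \<sigma> \<circ> \<tau>) b" by simp
    qed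
    then have "\<tau> = \<sigma>"
      by (metis comp_apply id_apply ext permutes_inverses(1)[OF \<sigma>])
    with less.prems(3) show False by simp
  qed
  then obtain a b where ab: "a \<in> {1..m}" "b \<in> {1..m}" "a < b" "f a = f b" "\<tau> b < \<tau> a"
    by blast
  let ?\<tau>' = "\<tau> \<circ> transpose a b"
  have shorter: "coxeter_length m ?\<tau>' < coxeter_length m \<tau>"
    by (rule coxeter_length_transpose_less) (use ab in auto)
  show ?case
  proof (cases "?\<tau>' = \<sigma>")
    case False
    have "coxeter_length m \<sigma> < coxeter_length m ?\<tau>'"
    proof (rule less.hyps[OF shorter _ _ False])
      show "?\<tau>' permutes {1..m}"
        by (rule permutes_compose[OF permutes_swap_id \<tau>]) (use ab in auto)
      show "f (inv \<sigma> (?\<tau>' k)) = f k" if "k \<in> {1..m}" for k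
        using that ab colour by (auto simp: transpose_def)
    qed
    with shorter show ?thesis by simp
  qed (use shorter in simp)
qed

lemma unique_min_lengthI:
  assumes "\<sigma> \<in> S"
    and "\<And>\<tau>. \<tau> \<in> S \<Longrightarrow> \<tau> \<noteq> \<sigma> \<Longrightarrow> coxeter_length m \<sigma> < coxeter_length m \<tau>"
  shows "unique_min_length m S \<sigma>"
  unfolding unique_min_length_def is_arg_min_def
  using assms by (auto dest: less_asym)

lemma unique_min_length_unique:
  assumes "unique_min_length m S \<sigma>" "unique_min_length m S \<tau>"
  shows "\<sigma> = \<tau>"
  using trans[OF sym[OF assms(1)[unfolded unique_min_length_def]]
      assms(2)[unfolded unique_min_length_def]]
  by simp

section \<open>Colouring by longest decreasing subsequences\<close>

text \<open>
  This is Mirsky's theorem for the order whose chains are the decreasing subsequences: \<open>c k\<close> is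
  the length of a longest decreasing subsequence that ends at position \<open>k\<close>, and it grows along
  every inversion.
\<close>
lemma ex_increasing_colouring:
  assumes \<sigma>: "\<sigma> permutes {1..m}"
  obtains c where "c \<in> {1..m} \<rightarrow> {1..LLDS m \<sigma>}"
    and "\<And>a b. a \<in> {1..m} \<Longrightarrow> b \<in> {1..m} \<Longrightarrow> a < b \<Longrightarrow> c a = c b \<Longrightarrow> \<sigma> a < \<sigma> b"
proof -
  define D where "D = {A. A \<subseteq> {1..m} \<and> monotone_on A (<) (>) \<sigma>}"
  define E where "E k = {A \<in> D. k \<in> A \<and> (\<forall>x\<in>A. x \<le> k)}" for k
  define c where "c k = Max (card ` E k)" for k
  have finD: "finite D" by (rule finite_subset[of _ "Pow {1..m}"]) (auto simp: D_def)
  then have finE: "finite (E k)" for k by (simp add: E_def)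
  have single: "{k} \<in> E k" if "k \<in> {1..m}" for k
    using that by (auto simp: E_def D_def monotone_on_def)
  have c_attained: "\<exists>A\<in>E k. c k = card A" if "k \<in> {1..m}" for k
  proof -
    have "c k \<in> card ` E k"
      unfolding c_def using finE single[OF that] by (intro Max_in) auto
    then show ?thesis by auto
  qed
  have c_ge: "card A \<le> c k" if "A \<in> E k" for A k
    using that finE by (auto simp: c_def)
  have "c k \<in> {1..LLDS m \<sigma>}" if k: "k \<in> {1..m}" for k
  proof -
    obtain A where A: "A \<in> E k" "c k = card A" using c_attained[OF k] by blast
    then have "c k \<le> LLDS m \<sigma>"
      using finD unfolding LLDS_def D_def[symmetric] by (auto simp: E_def)
    moreover have "1 \<le> c k" using c_ge[OF single[OF k]] by simp
    ultimately show ?thesis by simp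
  qed
  moreover have "\<sigma> a < \<sigma> b" if ab: "a \<in> {1..m}" "b \<in> {1..m}" "a < b" "c a = c b" for a b
  proof (rule ccontr)
    assume "\<not> \<sigma> a < \<sigma> b"
    moreover have "\<sigma> a \<noteq> \<sigma> b" using ab permutes_inj[OF \<sigma>] by (auto dest: injD)
    ultimately have desc: "\<sigma> b < \<sigma> a" by simp
    obtain A where A: "A \<in> E a" "c a = card A" using c_attained[OF ab(1)] by blast
    then have sub: "A \<subseteq> {1..m}" and dec: "\<And>x y. x \<in> A \<Longrightarrow> y \<in> A \<Longrightarrow> x < y \<Longrightarrow> \<sigma> y < \<sigma> x"
      and a: "a \<in> A" and last: "\<And>x. x \<in> A \<Longrightarrow> x \<le> a"
      by (auto simp: E_def D_def monotone_on_def)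
    have above: "\<sigma> b < \<sigma> x" if "x \<in> A" for x
      using dec[OF that a] last[OF that] desc by (cases "x = a") auto
    have "insert b A \<in> E b"
      using sub ab last dec above
      by (fastforce simp: E_def D_def monotone_on_def)
    from c_ge[OF this] have "card (insert b A) \<le> card A" using ab A by simp
    moreover have "b \<notin> A" "finite A" using last ab sub finite_subset by fastforce+
    ultimately show False by simp
  qed
  ultimately show thesis using that[of c] by blast
qed

section \<open>The tuples belonging to a permutation\<close>

lemma perms_B_ex_tuples:
  assumes "\<sigma> \<in> perms_B n r"
  shows "\<exists>i\<in>tuples n r. \<exists>j\<in>tuples n r.
    unique_min_length r {\<sigma>' \<in> perms_B n r. place_act r i \<sigma>' = j} \<sigma>"
proof -
  have \<sigma>: "\<sigma> permutes {1..r}" and bound: "LLDS r \<sigma> \<le> n"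
    using assms by (auto simp: perms_B_def sym_group_def)
  obtain c where c: "c \<in> {1..r} \<rightarrow> {1..LLDS r \<sigma>}"
    and incr: "\<And>a b. a \<in> {1..r} \<Longrightarrow> b \<in> {1..r} \<Longrightarrow> a < b \<Longrightarrow> c a = c b \<Longrightarrow> \<sigma> a < \<sigma> b"
    using ex_increasing_colouring[OF \<sigma>] by blast
  define j where "j = (\<lambda>k\<in>{1..r}. c k)"
  define i where "i = (\<lambda>v\<in>{1..r}. c (inv \<sigma> v))"
  have cn: "c k \<in> {1..n}" if "k \<in> {1..r}" for k using c that bound by fastforce
  have i_perm: "i (\<tau> k) = c (inv \<sigma> (\<tau> k))" if "\<tau> permutes {1..r}" "k \<in> {1..r}" for \<tau> k
    using that permutes_in_image[of \<tau> "{1..r}" k] by (simp add: i_def)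
  have "i \<in> tuples n r"
    unfolding i_def tuples_def
    using cn permutes_in_image[OF permutes_inv[OF \<sigma>]]
    by (intro restrict_PiE_iff[THEN iffD2]) blast
  moreover have "j \<in> tuples n r"
    unfolding j_def tuples_def using cn by (intro restrict_PiE_iff[THEN iffD2]) blast
  moreover have "unique_min_length r {\<sigma>' \<in> perms_B n r. place_act r i \<sigma>' = j} \<sigma>"
  proof (rule unique_min_lengthI)
    have "place_act r i \<sigma> = j"
      unfolding place_act_def j_def
      by (rule restrict_ext) (simp only: i_perm[OF \<sigma>] permutes_inverses(2)[OF \<sigma>])
    with assms show "\<sigma> \<in> {\<sigma>' \<in> perms_B n r. place_act r i \<sigma>' = j}" by simp
  next
    fix \<tau> assume "\<tau> \<in> {\<sigma>' \<in> perms_B n r. place_act r i \<sigma>' = j}" and neq: "\<tau> \<noteq> \<sigma>"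
    then have \<tau>: "\<tau> permutes {1..r}" and act: "place_act r i \<tau> = j"
      by (auto simp: perms_B_def sym_group_def)
    show "coxeter_length r \<sigma> < coxeter_length r \<tau>"
    proof (rule coxeter_length_less_if_increasing_on_colours[OF \<sigma> incr \<tau> _ neq])
      show "c (inv \<sigma> (\<tau> k)) = c k" if "k \<in> {1..r}" for k
        using fun_cong[OF act, of k] that i_perm[OF \<tau> that] by (simp add: place_act_def j_def)
    qed
  qed
  ultimately show ?thesis by blast
qed

text \<open>
  The entries of a tuple of positive length cannot form the empty set. If \<open>w\<close> is the identity and
  \<open>r > 0\<close>, no position lies outside the longest increasing subsequence, and position \<open>1\<close> is
  listed instead; fixing more values of \<open>w\<close> does no harm.
\<close>
lemma perms_C_ex_positions:
  assumes "n \<ge> 1" "w \<in> perms_C n r"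
  obtains j where "j \<in> tuples n r" "strict_mono_on ({1..n} - j ` {1..r}) w"
proof -
  define M where "M = {A. A \<subseteq> {1..n} \<and> strict_mono_on A w}"
  have "finite M" by (rule finite_subset[of _ "Pow {1..n}"]) (auto simp: M_def)
  moreover have "{} \<in> M" by (auto simp: M_def monotone_on_def)
  ultimately have "LLIS n w \<in> card ` M"
    unfolding LLIS_def M_def[symmetric] by (intro Max_in) auto
  then obtain A where A: "A \<subseteq> {1..n}" "strict_mono_on A w" "card A = LLIS n w"
    by (auto simp: M_def)
  have "card ({1..n} - A) = n - card A"
    using A(1) by (simp add: card_Diff_subset finite_subset[OF A(1)])
  also have "\<dots> \<le> r" using assms(2) A(3) by (auto simp: perms_C_def)
  finally have small: "card ({1..n} - A) \<le> r" .
  define J where "J = (if {1..n} - A = {} \<and> r > 0 then {1} else {1..n} - A)"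
  have J: "J \<subseteq> {1..n}" "{1..n} - A \<subseteq> J" "card J \<le> r"
    using small assms(1) by (auto simp: J_def)
  have J_empty: "J = {} \<longleftrightarrow> r = 0"
  proof (cases "{1..n} - A = {}")
    case False
    then have "0 < card ({1..n} - A)" unfolding card_gt_0_iff by simp
    with False small show ?thesis by (auto simp: J_def)
  qed (auto simp: J_def)
  have "\<exists>g. g ` {1..r} = J"
  proof (cases "r = 0")
    case False
    have "finite J" using J(1) finite_subset by blast
    then obtain h where h: "h ` J \<subseteq> {1..r}" "inj_on h J"
      using J(3) card_le_inj[of J "{1..r}"] by auto
    show ?thesis
    proof (intro exI set_eqI iffI)
      fix x
      let ?g = "\<lambda>k. if k \<in> h ` J then inv_into J h k else (SOME x. x \<in> J)"
      show "x \<in> J" if "x \<in> ?g ` {1..r}"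
        using that J_empty False by (auto simp: inv_into_into h(2) some_in_eq)
      show "x \<in> ?g ` {1..r}" if "x \<in> J"
        using that h by (intro image_eqI[of _ _ "h x"]) auto
    qed
  qed (use J_empty in auto)
  then obtain g where g: "g ` {1..r} = J" by blast
  define j where "j = restrict g {1..r}"
  have "j \<in> tuples n r" unfolding j_def tuples_def using g J(1) by auto
  moreover have "{1..n} - j ` {1..r} \<subseteq> A" using g J(2) by (auto simp: j_def)
  then have "strict_mono_on ({1..n} - j ` {1..r}) w"
    by (rule monotone_on_subset[OF A(2)])
  ultimately show thesis using that by blast
qed

lemma perms_C_ex_tuples:
  assumes "n \<ge> 1" "w \<in> perms_C n r"
  shows "\<exists>i\<in>tuples n r. \<exists>j\<in>tuples n r.
    unique_min_length n {w' \<in> perms_C n r. value_act r w' j = i} w"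
proof -
  have w: "w permutes {1..n}" using assms by (auto simp: perms_C_def sym_group_def)
  obtain j where j: "j \<in> tuples n r" and incr: "strict_mono_on ({1..n} - j ` {1..r}) w"
    using perms_C_ex_positions[OF assms] by blast
  have jn: "j k \<in> {1..n}" if "k \<in> {1..r}" for k
    using j that unfolding tuples_def by (rule PiE_mem)
  \<comment> \<open>Positions start at \<open>1\<close>, so \<open>0\<close> is free to serve as the common colour.\<close>
  define f where "f k = (if k \<in> j ` {1..r} then k else 0)" for k
  have "value_act r w j \<in> tuples n r"
    unfolding value_act_def tuples_def
    using jn permutes_in_image[OF w] by (intro restrict_PiE_iff[THEN iffD2]) blast
  moreover have "unique_min_length n {w' \<in> perms_C n r. value_act r w' j = value_act r w j} w"
  proof (rule unique_min_lengthI)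
    show "w \<in> {w' \<in> perms_C n r. value_act r w' j = value_act r w j}" using assms by simp
  next
    fix w' assume "w' \<in> {w' \<in> perms_C n r. value_act r w' j = value_act r w j}" and neq: "w' \<noteq> w"
    then have w': "w' permutes {1..n}" and act: "value_act r w' j = value_act r w j"
      by (auto simp: perms_C_def sym_group_def)
    have agree: "w' x = w x" if x: "x \<in> j ` {1..r}" for x
    proof -
      obtain k where "k \<in> {1..r}" "x = j k" using x by blast
      then show ?thesis using fun_cong[OF act, of k] by (simp add: value_act_def)
    qed
    show "coxeter_length n w < coxeter_length n w'"
    proof (rule coxeter_length_less_if_increasing_on_colours[OF w _ w' _ neq])
      show "w a < w b" if "a \<in> {1..n}" "b \<in> {1..n}" "a < b" "f a = f b" for a b
        using that incr by (auto simp: f_def monotone_on_def split: if_splits)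
      show "f (inv w (w' k)) = f k" for k
      proof (cases "k \<in> j ` {1..r}")
        case True
        then show ?thesis using agree by (simp add: permutes_inverses(2)[OF w])
      next
        case False
        have "inv w (w' k) \<notin> j ` {1..r}"
        proof
          assume "inv w (w' k) \<in> j ` {1..r}"
          from agree[OF this] have "inv w (w' k) = k"
            using permutes_inj[OF w'] by (auto simp: permutes_inverses(1)[OF w] dest: injD)
          with \<open>inv w (w' k) \<in> j ` {1..r}\<close> False show False by simp
        qed
        with False show ?thesis by (simp add: f_def)
      qed
    qed
  qed
  ultimately show ?thesis using j by blast
qed

section \<open>The injections\<close>

text \<open>
  Here injectivity comes for free, as \<open>S i j\<close> depends only on the chosen pair \<open>(i, j)\<close>.
\<close>
lemma ex_injection_if_ex_unique_min_length:
  assumes "\<And>\<sigma>. \<sigma> \<in> P \<Longrightarrow> \<exists>i\<in>T. \<exists>j\<in>T. unique_min_length m (S i j) \<sigma>"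
  shows "\<exists>\<phi>. \<phi> \<in> P \<rightarrow> T \<times> T \<and> inj_on \<phi> P \<and>
    (\<forall>\<sigma>\<in>P. \<forall>i j. \<phi> \<sigma> = (i, j) \<longrightarrow> unique_min_length m (S i j) \<sigma>)"
proof -
  have "\<forall>\<sigma>\<in>P. \<exists>p. p \<in> T \<times> T \<and> unique_min_length m (S (fst p) (snd p)) \<sigma>"
  proof
    fix \<sigma> assume "\<sigma> \<in> P"
    from assms[OF this] obtain i j where "i \<in> T" "j \<in> T" "unique_min_length m (S i j) \<sigma>" by blast
    then show "\<exists>p. p \<in> T \<times> T \<and> unique_min_length m (S (fst p) (snd p)) \<sigma>"
      by (intro exI[of _ "(i, j)"]) simp
  qed
  from bchoice[OF this] obtain \<phi> where
    "\<forall>\<sigma>\<in>P. \<phi> \<sigma> \<in> T \<times> T \<and> unique_min_length m (S (fst (\<phi> \<sigma>)) (snd (\<phi> \<sigma>))) \<sigma>"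
    ..
  then have maps: "\<phi> \<in> P \<rightarrow> T \<times> T"
    and min: "\<And>\<sigma>. \<sigma> \<in> P \<Longrightarrow> unique_min_length m (S (fst (\<phi> \<sigma>)) (snd (\<phi> \<sigma>))) \<sigma>"
    by auto
  have "inj_on \<phi> P"
  proof (rule inj_onI)
    fix \<sigma> \<tau> assume "\<sigma> \<in> P" "\<tau> \<in> P" "\<phi> \<sigma> = \<phi> \<tau>"
    then show "\<sigma> = \<tau>"
      using min[of \<sigma>] min[of \<tau>] by (auto intro: unique_min_length_unique)
  qed
  moreover have "\<forall>\<sigma>\<in>P. \<forall>i j. \<phi> \<sigma> = (i, j) \<longrightarrow> unique_min_length m (S i j) \<sigma>"
  proof (intro ballI allI impI)
    fix \<sigma> i j assume "\<sigma> \<in> P" "\<phi> \<sigma> = (i, j)"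
    then show "unique_min_length m (S i j) \<sigma>" using min[of \<sigma>] by simp
  qed
  ultimately show ?thesis using maps by blast
qed

theorem theorem2p1:
  fixes n r :: nat
  assumes "n \<ge> 1"
  shows "\<exists>\<phi> \<psi>.
    \<phi> \<in> perms_B n r \<rightarrow> tuples n r \<times> tuples n r \<and> inj_on \<phi> (perms_B n r) \<and>
    \<psi> \<in> perms_C n r \<rightarrow> tuples n r \<times> tuples n r \<and> inj_on \<psi> (perms_C n r) \<and>
    (\<forall>\<sigma>\<in>perms_B n r. \<forall>i j. \<phi> \<sigma> = (i, j) \<longrightarrow>
       unique_min_length r {\<sigma>' \<in> perms_B n r. place_act r i \<sigma>' = j} \<sigma>) \<and>
    (\<forall>w\<in>perms_C n r. \<forall>i j. \<psi> w = (i, j) \<longrightarrow>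
       unique_min_length n {w' \<in> perms_C n r. value_act r w' j = i} w)"
proof -
  obtain \<phi> where "\<phi> \<in> perms_B n r \<rightarrow> tuples n r \<times> tuples n r" "inj_on \<phi> (perms_B n r)"
    "\<forall>\<sigma>\<in>perms_B n r. \<forall>i j. \<phi> \<sigma> = (i, j) \<longrightarrow>
       unique_min_length r {\<sigma>' \<in> perms_B n r. place_act r i \<sigma>' = j} \<sigma>"
    using ex_injection_if_ex_unique_min_length[OF perms_B_ex_tuples] by blast
  moreover obtain \<psi> where "\<psi> \<in> perms_C n r \<rightarrow> tuples n r \<times> tuples n r" "inj_on \<psi> (perms_C n r)"
    "\<forall>w\<in>perms_C n r. \<forall>i j. \<psi> w = (i, j) \<longrightarrow>
       unique_min_length n {w' \<in> perms_C n r. value_act r w' j = i} w"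
    using ex_injection_if_ex_unique_min_length[OF perms_C_ex_tuples[OF assms]] by blast
  ultimately show ?thesis by blast
qed

end
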